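(* Let $m\le n$, let $Q\in\mathcal{O}(m,n)$ and let $S=[s_{ij}]=\operatorname{sgn}(Q)$. The smooth manifolds $\mathcal{Q}(S)$ and $\mathcal{O}(m,n)$ (viewed as submanifolds of $\mathbb{R}^{m\times n}$) intersect transversally at $Q$ if and only if $Q$ has the strong inner product property. Further, if $Q$ has the strong inner product property, then every super pattern of $S$ allows orthogonality.
   Context: All matrices are real; $\circ$ denotes the Hadamard product. $\mathcal{O}(m,n)=\{Q\in\mathbb{R}^{m\times n}:QQ^T=I\}$ is the set of row orthogonal matrices. A matrix $M\in\mathbb{R}^{m\times n}$ with $m\le n$ has the strong inner product property (SIPP) if $M$ has rank $m$ and $X=O$ is the only symmetric $m\times m$ matrix $X$ with $(XM)\circ M=O$. A sign pattern is a $(0,1,-1)$-matrix; $\operatorname{sgn}(A)$ is the entrywise sign of $A$; $\mathcal{Q}(S)=\{A\in\mathbb{R}^{m\times n}:\operatorname{sgn}(A)=S\}$. $S$ allows orthogonality if $\mathcal{Q}(S)\cap\mathcal{O}(m,n)\neq\emptyset$. For sign patterns $S=[s_{ij}]$, $R=[r_{ij}]$ of the same size, $S_{\vec R}$ is the sign pattern with $(i,j)$-entry $s_{ij}$ if $s_{ij}\ne0$ and $r_{ij}$ otherwise; a super pattern of $S$ is any sign pattern of the form $S_{\vec R}$. Two submanifolds $\mathcal{M}_1,\mathcal{M}_2$ of $\mathbb{R}^d$ intersect transversally at $x$ if $x\in\mathcal{M}_1\cap\mathcal{M}_2$ and their tangent spaces at $x$ sum to $\mathbb{R}^d$ (equivalently,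 their normal spaces at $x$ intersect only in $0$), with $\mathbb{R}^{m\times n}$ carrying the inner product $\langle A,B\rangle=\operatorname{tr}(AB^T)$. *)

theory Defs
  imports "HOL-Analysis.Analysis"
begin

text \<open>An \<open>m \<times> n\<close> real matrix is an element of \<^typ>\<open>real^'n^'m\<close>, with \<open>m = CARD('m)\<close> and
  \<open>n = CARD('n)\<close>.\<close>

definition hadamard :: "real^'n^'m \<Rightarrow> real^'n^'m \<Rightarrow> real^'n^'m" (infixl "\<circ>\<^sub>H" 70) where
  "A \<circ>\<^sub>H B = (\<chi> i j. A$i$j * B$i$j)"

definition row_orthogonal :: "(real^'n^'m) set" where
  "row_orthogonal = {Q. Q ** transpose Q = mat 1}"

definition SIPP :: "real^'n^'m \<Rightarrow> bool" where
  "SIPP M \<longleftrightarrow> CARD('m) \<le> CARD('n) \<and> rank M = CARD('m) \<and>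
     (\<forall>X::real^'m^'m. transpose X = X \<and> (X ** M) \<circ>\<^sub>H M = 0 \<longrightarrow> X = 0)"

definition sign_pattern :: "real^'n^'m \<Rightarrow> bool" where
  "sign_pattern S \<longleftrightarrow> (\<forall>i j. S$i$j \<in> {0, 1, -1})"

text \<open>The library's \<^const>\<open>sgn\<close> on vectors normalises the length, so the entrywise sign needs its own
  constant.\<close>

definition sgn_mat :: "real^'n^'m \<Rightarrow> real^'n^'m" where
  "sgn_mat A = (\<chi> i j. sgn (A$i$j))"

definition qual_class :: "real^'n^'m \<Rightarrow> (real^'n^'m) set" where
  "qual_class S = {A. sgn_mat A = S}"

definition allows_orthogonality :: "real^'n^'m \<Rightarrow> bool" where
  "allows_orthogonality S \<longleftrightarrow> qual_class S \<inter> row_orthogonal \<noteq> {}"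

definition pattern_fill :: "real^'n^'m \<Rightarrow> real^'n^'m \<Rightarrow> real^'n^'m" where
  "pattern_fill S R = (\<chi> i j. if S$i$j \<noteq> 0 then S$i$j else R$i$j)"

definition super_pattern :: "real^'n^'m \<Rightarrow> real^'n^'m \<Rightarrow> bool" where
  "super_pattern S T \<longleftrightarrow> (\<exists>R. sign_pattern R \<and> T = pattern_fill S R)"

text \<open>\<open>C\<^sup>k\<close> and \<open>C\<^sup>\<infinity>\<close> functions; meant for open \<open>U\<close>.\<close>

primrec Ck_on :: "nat \<Rightarrow> ('a::real_normed_vector \<Rightarrow> 'b::real_normed_vector) \<Rightarrow> 'a set \<Rightarrow> bool" where
  "Ck_on 0 f U \<longleftrightarrow> continuous_on U f"
| "Ck_on (Suc k) f U \<longleftrightarrow> (\<forall>x\<in>U. f differentiable (at x)) \<and>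
     (\<forall>v. Ck_on k (\<lambda>x. frechet_derivative f (at x) v) U)"

definition smooth_on :: "'a set \<Rightarrow> ('a::real_normed_vector \<Rightarrow> 'b::real_normed_vector) \<Rightarrow> bool" where
  "smooth_on U f \<longleftrightarrow> (\<forall>k. Ck_on k f U)"

text \<open>An embedded smooth submanifold, of constant codimension \<open>c\<close>: locally a regular level set of a
  smooth map \<open>F = (F 0, \<dots>, F (c - 1))\<close> into \<open>\<real>\<^sup>c\<close>, i.e. the derivative of \<open>F\<close> maps onto \<open>\<real>\<^sup>c\<close> at every
  point of the level set.\<close>

definition smooth_submanifold :: "'a::euclidean_space set \<Rightarrow> bool" where
  "smooth_submanifold M \<longleftrightarrow> (\<exists>c::nat. \<forall>x\<in>M. \<exists>U (F :: nat \<Rightarrow> 'a \<Rightarrow> real).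
     open U \<and> x \<in> U \<and> (\<forall>i<c. smooth_on U (F i)) \<and>
     M \<inter> U = {y\<in>U. \<forall>i<c. F i y = 0} \<and>
     (\<forall>y\<in>M \<inter> U. \<forall>w::nat \<Rightarrow> real. \<exists>v. \<forall>i<c. frechet_derivative (F i) (at y) v = w i))"

text \<open>For a submanifold, the tangent space at a point is the set of velocities of smooth curves in the
  submanifold through that point.\<close>

definition tangent_space :: "'a::euclidean_space set \<Rightarrow> 'a \<Rightarrow> 'a set" where
  "tangent_space M x = {v. \<exists>\<epsilon>>0. \<exists>\<gamma>::real \<Rightarrow> 'a. smooth_on {-\<epsilon><..<\<epsilon>} \<gamma> \<and>
     \<gamma> ` {-\<epsilon><..<\<epsilon>} \<subseteq> M \<and> \<gamma> 0 = x \<and> (\<gamma> has_vector_derivative v) (at 0)}"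

definition intersect_transversally :: "'a::euclidean_space set \<Rightarrow> 'a set \<Rightarrow> 'a \<Rightarrow> bool" where
  "intersect_transversally M\<^sub>1 M\<^sub>2 x \<longleftrightarrow> x \<in> M\<^sub>1 \<inter> M\<^sub>2 \<and>
     {u + v | u v. u \<in> tangent_space M\<^sub>1 x \<and> v \<in> tangent_space M\<^sub>2 x} = UNIV"

end

theory Submission
  imports Defs
begin

text \<open>The tangent space of the qualitative class at \<open>Q\<close> consists of the matrices supported on the nonzero entries
  of \<open>Q\<close>. That of the row orthogonal matrices is \<open>{V. V ** transpose Q skew}\<close>: such a \<open>V\<close> equals \<open>Q ** K\<close> with \<open>K\<close>
  skew and is the initial velocity of the solution of \<open>\<gamma>' = \<gamma> ** K\<close>, \<open>\<gamma> 0 = Q\<close>, which stays row orthogonal. The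
  orthogonal complements are \<open>{N. N \<circ>\<^sub>H Q = 0}\<close> and \<open>{X ** Q | X symmetric}\<close>, and these meet only in \<open>0\<close> exactly when
  \<open>Q\<close> has the SIPP.

  Transversality says that the derivative of \<open>A \<mapsto> A ** transpose A\<close>, restricted to matrices supported on the
  nonzero entries of \<open>Q\<close>, is onto the symmetric matrices. Hence a small perturbation of the zero entries of \<open>Q\<close>, of
  any prescribed sign pattern, can be compensated by a small change of the nonzero entries.\<close>

section \<open>Smoothness of polynomials, lines and solutions of linear ODEs\<close>

lemma Ck_on_const: "Ck_on k (\<lambda>x. c) U"
  by (induction k arbitrary: c) (auto simp: frechet_derivative_const)

text \<open>Polynomials are closed under directional derivatives, so the recursion in
  \<open>Ck_on\<close> never leaves them and smoothness follows by induction on the order.\<close>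

lemma real_polynomial_function_derivative:
  fixes f :: "'a::real_normed_vector \<Rightarrow> real"
  assumes "real_polynomial_function f"
  shows "\<exists>f'. (\<forall>x. (f has_derivative f' x) (at x)) \<and> (\<forall>v. real_polynomial_function (\<lambda>x. f' x v))"
  using assms
proof induction
  case (linear f)
  then show ?case
    by (intro exI[of _ "\<lambda>x. f"]) (auto intro: bounded_linear_imp_has_derivative)
next
  case (const c)
  then show ?case
    by (intro exI[of _ "\<lambda>x v. 0"]) auto
next
  case (add f g)
  then obtain f' g' where "\<And>x. (f has_derivative f' x) (at x)" "\<And>x. (g has_derivative g' x) (at x)"
    "\<And>v. real_polynomial_function (\<lambda>x. f' x v)" "\<And>v. real_polynomial_function (\<lambda>x. g' x v)"
    by blast
  then show ?case
    by (intro exI[of _ "\<lambda>x v. f' x v + g' x v"]) (auto intro: has_derivative_add)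
next
  case (mult f g)
  then obtain f' g' where "\<And>x. (f has_derivative f' x) (at x)" "\<And>x. (g has_derivative g' x) (at x)"
    "\<And>v. real_polynomial_function (\<lambda>x. f' x v)" "\<And>v. real_polynomial_function (\<lambda>x. g' x v)"
    by blast
  with mult.hyps show ?case
    by (intro exI[of _ "\<lambda>x v. f x * g' x v + f' x v * g x"])
      (auto intro!: has_derivative_mult real_polynomial_function.intros(3,4))
qed

lemma smooth_on_real_polynomial_function:
  fixes f :: "'a::real_normed_vector \<Rightarrow> real"
  assumes "real_polynomial_function f"
  shows "smooth_on U f"
proof -
  have "Ck_on k f U" for k
    using assms
  proof (induction k arbitrary: f)
    case 0
    then show ?case
      by (simp add: continuous_on_polymonial_function real_polynomial_function_eq)
  next
    case (Suc k)
    obtain f' where f': "\<And>x. (f has_derivative f' x) (at x)"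
      "\<And>v. real_polynomial_function (\<lambda>x. f' x v)"
      using real_polynomial_function_derivative[OF Suc.prems] by blast
    have "frechet_derivative f (at x) = f' x" for x
      using frechet_derivative_at[OF f'(1)] by simp
    with Suc.IH[OF f'(2)] f'(1) show ?case
      by (auto simp: differentiable_def)
  qed
  then show ?thesis
    by (simp add: smooth_on_def)
qed

lemma smooth_on_affine_curve: "smooth_on U (\<lambda>t::real. x + t *\<^sub>R v)"
proof -
  have d: "((\<lambda>t::real. x + t *\<^sub>R v) has_derivative (\<lambda>s. s *\<^sub>R v)) (at t)" for t
    by (auto intro!: derivative_eq_intros)
  have "Ck_on k (\<lambda>t::real. x + t *\<^sub>R v) U" for k
  proof (cases k)
    case 0
    then show ?thesis by (auto intro!: continuous_intros)
  next
    case (Suc l)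
    have "(\<lambda>t. frechet_derivative (\<lambda>t::real. x + t *\<^sub>R v) (at t) w) = (\<lambda>t. w *\<^sub>R v)" for w
      using frechet_derivative_at[OF d] by metis
    with Suc d show ?thesis
      by (auto simp: differentiable_def Ck_on_const)
  qed
  then show ?thesis
    by (simp add: smooth_on_def)
qed

text \<open>Differentiating \<open>L (\<gamma> t)\<close> gives \<open>L (A (\<gamma> t))\<close> up
  to a scalar, again a bounded linear image of \<open>\<gamma>\<close>. The induction therefore runs
  over all bounded linear \<open>L\<close> at once; \<open>L\<close> is the identity at the
  end.\<close>

lemma smooth_on_linear_ode_solution:
  fixes \<gamma> :: "real \<Rightarrow> 'a::real_normed_vector"
  assumes A: "bounded_linear A"
    and ode: "\<And>t. (\<gamma> has_vector_derivative A (\<gamma> t)) (at t)"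
  shows "smooth_on U \<gamma>"
proof -
  have "Ck_on k (\<lambda>t. L (\<gamma> t)) U" if "bounded_linear L" for k and L :: "'a \<Rightarrow> 'a"
    using that
  proof (induction k arbitrary: L)
    case 0
    have "continuous_on U \<gamma>"
      using ode by (meson continuous_at_imp_continuous_on has_vector_derivative_continuous)
    then show ?case
      using bounded_linear.continuous_on[OF 0] by simp
  next
    case (Suc k)
    have d: "((\<lambda>t. L (\<gamma> t)) has_derivative (\<lambda>s. s *\<^sub>R L (A (\<gamma> t)))) (at t)" for t
      using bounded_linear.has_vector_derivative[OF Suc.prems ode] by (simp add: has_vector_derivative_def)
    have "(\<lambda>t. frechet_derivative (\<lambda>t. L (\<gamma> t)) (at t) w) = (\<lambda>t. w *\<^sub>R L (A (\<gamma> t)))" for w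
      using frechet_derivative_at[OF d] by metis
    moreover have "Ck_on k (\<lambda>t. w *\<^sub>R L (A (\<gamma> t))) U" for w
      by (rule Suc.IH[of "\<lambda>x. w *\<^sub>R L (A x)"])
        (intro bounded_linear_intros bounded_linear_compose[OF Suc.prems A])
    ultimately show ?case
      using d by (auto simp: differentiable_def)
  qed
  from this[OF bounded_linear_ident] show ?thesis
    by (simp add: smooth_on_def)
qed

text \<open>The solution is the exponential of \<open>t A\<close> applied to \<open>x\<close>,
  written as a power series in \<open>t\<close> and dominated by a scalar exponential series. It is
  differentiated termwise after taking inner products, which reduces to real power series.\<close>

lemma linear_ode_solution_exists:
  fixes A :: "'a::euclidean_space \<Rightarrow> 'a" and x :: 'a
  assumes A: "bounded_linear A"
  shows "\<exists>\<gamma>. \<gamma> 0 = x \<and> (\<forall>t. (\<gamma> has_vector_derivative A (\<gamma> t)) (at t))"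
proof -
  obtain B where B: "B > 0" "\<And>y. norm (A y) \<le> norm y * B"
    using bounded_linear.pos_bounded[OF A] by blast
  define u where "u n = (A ^^ n) x" for n
  have u_le: "norm (u n) \<le> B ^ n * norm x" for n
  proof (induction n)
    case (Suc n)
    have "norm (u (Suc n)) \<le> norm (u n) * B"
      using B(2) by (simp add: u_def)
    also have "\<dots> \<le> B ^ n * norm x * B"
      using Suc B(1) by (intro mult_right_mono) auto
    finally show ?case by (simp add: mult_ac)
  qed (simp add: u_def)
  have summ: "summable (\<lambda>n. (t ^ n / fact n) *\<^sub>R u n)" for t :: real
  proof (rule summable_comparison_test')
    show "summable (\<lambda>n. norm x * (inverse (fact n) * (\<bar>t\<bar> * B) ^ n))"
      by (intro summable_mult summable_exp)
    show "norm ((t ^ n / fact n) *\<^sub>R u n) \<le> norm x * (inverse (fact n) * (\<bar>t\<bar> * B) ^ n)" for n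
      using mult_left_mono[OF u_le[of n], of "\<bar>t\<bar> ^ n / fact n"]
      by (simp add: power_abs power_mult_distrib field_simps)
  qed
  define \<gamma> where "\<gamma> t = (\<Sum>n. (t ^ n / fact n) *\<^sub>R u n)" for t :: real
  have inner_\<gamma>: "\<gamma> t \<bullet> b = (\<Sum>n. (u n \<bullet> b / fact n) * t ^ n)" for t b
    unfolding \<gamma>_def bounded_linear.suminf[OF bounded_linear_inner_left summ]
    by (simp add: mult_ac)
  have inner_summ: "summable (\<lambda>n. (u n \<bullet> b / fact n) * t ^ n)" for t b
    using bounded_linear.summable[OF bounded_linear_inner_left[of b] summ[of t]]
    by (simp add: mult_ac)
  have A\<gamma>: "A (\<gamma> t) = (\<Sum>n. (t ^ n / fact n) *\<^sub>R u (Suc n))" for t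
    unfolding \<gamma>_def bounded_linear.suminf[OF A summ]
    by (simp add: u_def linear_cmul[OF bounded_linear.linear[OF A]])
  have A_summ: "summable (\<lambda>n. (t ^ n / fact n) *\<^sub>R u (Suc n))" for t
    using bounded_linear.summable[OF A summ[of t]]
    by (simp add: u_def linear_cmul[OF bounded_linear.linear[OF A]])
  \<comment> \<open>The factor \<open>Suc n\<close> from differentiation cancels against
    \<open>fact (Suc n)\<close>, so differentiating only shifts \<open>u n\<close> to
    \<open>u (Suc n)\<close>, which is \<open>A (u n)\<close>.\<close>
  have diffs: "diffs (\<lambda>n. u n \<bullet> b / fact n) n = u (Suc n) \<bullet> b / fact n" for b n
    by (simp add: diffs_def del: of_nat_Suc)
  have "((\<lambda>t. \<gamma> t \<bullet> b) has_field_derivative A (\<gamma> t) \<bullet> b) (at t)" for t b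
    using termdiffs_strong_converges_everywhere[OF inner_summ, of b t]
    unfolding inner_\<gamma> A\<gamma> diffs bounded_linear.suminf[OF bounded_linear_inner_left A_summ]
    by (simp add: mult_ac)
  then have "(\<gamma> has_vector_derivative A (\<gamma> t)) (at t)" for t
    unfolding has_vector_derivative_def has_field_derivative_def
    by (subst has_derivative_componentwise_within) (simp add: mult.commute[of _ "_ \<bullet> _"])
  moreover have "\<gamma> 0 = x"
    unfolding \<gamma>_def using suminf_finite[of "{0}" "\<lambda>n. ((0::real) ^ n / fact n) *\<^sub>R u n"]
    by (auto simp: u_def)
  ultimately show ?thesis by blast
qed

section \<open>A criterion for submanifolds\<close>

text \<open>Allows the defining equations to be indexed by any finite set, such as pairs of matrix
  indices, with explicitly given derivatives. An enumeration of \<open>P\<close> translates to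
  numbered equations, and the codimension is \<open>card P\<close>.\<close>

lemma smooth_submanifoldI:
  fixes M :: "'a::euclidean_space set" and P :: "'i set"
  assumes "finite P"
    and local: "\<And>x. x \<in> M \<Longrightarrow> \<exists>U (F :: 'i \<Rightarrow> 'a \<Rightarrow> real) F'. open U \<and> x \<in> U \<and>
      (\<forall>p\<in>P. smooth_on U (F p)) \<and> M \<inter> U = {y\<in>U. \<forall>p\<in>P. F p y = 0} \<and>
      (\<forall>p\<in>P. \<forall>y\<in>M \<inter> U. (F p has_derivative F' p y) (at y)) \<and>
      (\<forall>y\<in>M \<inter> U. \<forall>w. \<exists>v. \<forall>p\<in>P. F' p y v = w p)"
  shows "smooth_submanifold M"
proof -
  obtain h where "bij_betw h {0..<card P} P"
    using ex_bij_betw_nat_finite[OF \<open>finite P\<close>] by blast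
  then have h: "\<And>i. i < card P \<Longrightarrow> h i \<in> P" "\<And>p. p \<in> P \<Longrightarrow> \<exists>i<card P. h i = p" "inj_on h {0..<card P}"
    by (force simp: bij_betw_def)+
  show ?thesis
    unfolding smooth_submanifold_def
  proof (intro exI[of _ "card P"] ballI)
    fix x assume "x \<in> M"
    from local[OF this] obtain U and F :: "'i \<Rightarrow> 'a \<Rightarrow> real" and F' where
      U: "open U" "x \<in> U" "\<forall>p\<in>P. smooth_on U (F p)"
      and M: "M \<inter> U = {y\<in>U. \<forall>p\<in>P. F p y = 0}"
      and "\<forall>p\<in>P. \<forall>y\<in>M \<inter> U. (F p has_derivative F' p y) (at y)"
      and surj: "\<forall>y\<in>M \<inter> U. \<forall>w. \<exists>v. \<forall>p\<in>P. F' p y v = w p"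
      by (elim exE conjE)
    then have F': "\<And>p y. p \<in> P \<Longrightarrow> y \<in> M \<inter> U \<Longrightarrow> (F p has_derivative F' p y) (at y)"
      by blast
    have "\<exists>v. \<forall>i<card P. frechet_derivative (F (h i)) (at y) v = w i" if y: "y \<in> M \<inter> U" for y w
    proof -
      obtain v where v: "\<And>p. p \<in> P \<Longrightarrow> F' p y v = w (the_inv_into {0..<card P} h p)"
        using surj[THEN bspec, OF y, THEN spec, of "\<lambda>p. w (the_inv_into {0..<card P} h p)"] by blast
      have "frechet_derivative (F (h i)) (at y) v = w i" if "i < card P" for i
        using that h v[of "h i"] frechet_derivative_at[OF F'[OF h(1) y], of i]
        by (simp add: the_inv_into_f_f)
      then show ?thesis by blast
    qed
    moreover have "M \<inter> U = {y\<in>U. \<forall>i<card P. F (h i) y = 0}"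
      unfolding M using h(1,2) by blast
    ultimately show "\<exists>U (F :: nat \<Rightarrow> 'a \<Rightarrow> real). open U \<and> x \<in> U \<and> (\<forall>i<card P. smooth_on U (F i)) \<and>
      M \<inter> U = {y\<in>U. \<forall>i<card P. F i y = 0} \<and>
      (\<forall>y\<in>M \<inter> U. \<forall>w. \<exists>v. \<forall>i<card P. frechet_derivative (F i) (at y) v = w i)"
      using U h(1) by (intro exI[of _ U] exI[of _ "\<lambda>i. F (h i)"]) blast
  qed
qed

section \<open>Matrix algebra and the trace inner product\<close>

lemma bounded_bilinear_matrix_mult:
  "bounded_bilinear ((**) :: real^'n^'m \<Rightarrow> real^'k^'n \<Rightarrow> real^'k^'m)"
  unfolding bilinear_conv_bounded_bilinear[symmetric] bilinear_def
  by (auto intro!: linearI simp: vec_eq_iff matrix_matrix_mult_def algebra_simps sum.distrib sum_distrib_left)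

lemma bounded_linear_transpose: "bounded_linear (transpose :: real^'n^'m \<Rightarrow> real^'m^'n)"
  unfolding linear_conv_bounded_linear[symmetric]
  by (auto intro!: linearI simp: vec_eq_iff transpose_def)

lemmas matrix_mult_simps =
  bounded_bilinear.add_left[OF bounded_bilinear_matrix_mult]
  bounded_bilinear.add_right[OF bounded_bilinear_matrix_mult]
  bounded_bilinear.diff_left[OF bounded_bilinear_matrix_mult]
  bounded_bilinear.diff_right[OF bounded_bilinear_matrix_mult]
  bounded_bilinear.minus_left[OF bounded_bilinear_matrix_mult]
  bounded_bilinear.minus_right[OF bounded_bilinear_matrix_mult]
  bounded_bilinear.scaleR_left[OF bounded_bilinear_matrix_mult]
  bounded_bilinear.scaleR_right[OF bounded_bilinear_matrix_mult]

lemmas transpose_simps =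
  linear_add[OF bounded_linear.linear[OF bounded_linear_transpose]]
  linear_diff[OF bounded_linear.linear[OF bounded_linear_transpose]]
  linear_neg[OF bounded_linear.linear[OF bounded_linear_transpose]]
  linear_cmul[OF bounded_linear.linear[OF bounded_linear_transpose]]
  linear_0[OF bounded_linear.linear[OF bounded_linear_transpose]]
  matrix_transpose_mul transpose_transpose

text \<open>Moving \<open>Q\<close> across the inner product is what shows \<open>X ** Q\<close>
  with \<open>X\<close> symmetric to be normal to the row orthogonal matrices: a symmetric matrix
  ends up paired with a skew one.\<close>

lemma matrix_mult_inner_adjoint:
  fixes X :: "real^'k^'m" and Q :: "real^'n^'k" and V :: "real^'n^'m"
  shows "(X ** Q) \<bullet> V = X \<bullet> (V ** transpose Q)"
proof -
  have "(\<Sum>j\<in>UNIV. (\<Sum>k\<in>UNIV. X$i$k * Q$k$j) * V$i$j) = (\<Sum>k\<in>UNIV. X$i$k * (\<Sum>j\<in>UNIV. V$i$j * Q$k$j))" for i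
    unfolding sum_distrib_left sum_distrib_right by (subst sum.swap) (simp add: mult_ac)
  then show ?thesis
    by (simp add: inner_vec_def matrix_matrix_mult_def transpose_def)
qed

lemma transpose_inner_transpose:
  fixes A B :: "real^'n^'m"
  shows "transpose A \<bullet> transpose B = A \<bullet> B"
  unfolding inner_vec_def transpose_def by (simp, rule sum.swap)

lemma symmetric_inner_skew:
  fixes X Y :: "real^'m^'m"
  assumes "transpose X = X" "transpose Y = - Y"
  shows "X \<bullet> Y = 0"
  using transpose_inner_transpose[of X Y] assms by simp

lemma matrix_mult_transpose_component:
  fixes A B :: "real^'n^'m"
  shows "(A ** transpose B)$i$j = A$i \<bullet> B$j"
  by (simp add: matrix_matrix_mult_def transpose_def inner_vec_def)

lemma bounded_linear_matrix_component: "bounded_linear (\<lambda>A::real^'n^'m. A$i$j)"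
  using bounded_linear_compose[OF bounded_linear_vec_nth bounded_linear_vec_nth] .

lemma row_orthogonal_iff:
  "Q \<in> row_orthogonal \<longleftrightarrow> (\<forall>i j. Q$i \<bullet> Q$j = (if i = j then 1 else 0))"
  by (simp add: row_orthogonal_def vec_eq_iff matrix_mult_transpose_component mat_def)

section \<open>The two sets are smooth submanifolds\<close>

text \<open>Nonzero entries keep their signs under small changes, so locally the class is cut out by
  the linear equations that the entries at the zeros of \<open>S\<close> vanish.\<close>

lemma smooth_submanifold_qual_class: "smooth_submanifold (qual_class (S :: real^'n^'m))"
proof (rule smooth_submanifoldI[of "{(i,j). S$i$j = 0}"])
  fix x assume "x \<in> qual_class S"
  then have x: "sgn (x$i$j) = S$i$j" for i j
    by (auto simp: qual_class_def sgn_mat_def)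
  \<comment> \<open>On \<open>U\<close> every entry at a nonzero position of \<open>S\<close>
    already has the sign prescribed there.\<close>
  define U where "U = (\<Inter>p. {y :: real^'n^'m. S$fst p$snd p = 0 \<or> y$fst p$snd p * S$fst p$snd p > 0})"
  have U: "open U"
    unfolding U_def
    by (intro open_INT finite_class.finite_UNIV ballI open_Collect_disj open_Collect_const open_Collect_less continuous_intros)
  have mem_U: "y \<in> U \<longleftrightarrow> (\<forall>i j. S$i$j = 0 \<or> y$i$j * S$i$j > 0)" for y
    by (auto simp: U_def)
  have S: "S$i$j = 0 \<or> S$i$j = 1 \<or> S$i$j = -1" for i j
    using x[of i j] by (metis sgn_real_def)
  have "sgn (y$i$j) = S$i$j \<longleftrightarrow> (S$i$j = 0 \<longrightarrow> y$i$j = 0)" if "y \<in> U" for y i j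
  proof -
    have "S$i$j = 0 \<or> y$i$j * S$i$j > 0"
      using that mem_U by blast
    with S[of i j] show ?thesis
      by (elim disjE) (simp_all add: sgn_real_def)
  qed
  then have "qual_class S \<inter> U = {y \<in> U. \<forall>(i,j)\<in>{(i,j). S$i$j = 0}. y$i$j = 0}"
    unfolding qual_class_def sgn_mat_def vec_eq_iff by simp blast
  moreover have "x \<in> U"
    unfolding mem_U by (auto simp: x[symmetric] sgn_real_def)
  moreover have "((\<lambda>y. y$i$j) has_derivative (\<lambda>y. y$i$j)) (at x)"
      and "bounded_linear (\<lambda>y::real^'n^'m. y$i$j)" for i j and x :: "real^'n^'m"
    by (intro bounded_linear_imp_has_derivative bounded_linear_matrix_component)+
  moreover have "\<exists>v::real^'n^'m. \<forall>(i,j)\<in>{(i,j). S$i$j = 0}. v$i$j = w (i,j)" for w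
    by (intro exI[of _ "\<chi> i j. w (i,j)"]) auto
  ultimately show "\<exists>U (F :: 'm \<times> 'n \<Rightarrow> real^'n^'m \<Rightarrow> real) F'. open U \<and> x \<in> U \<and>
      (\<forall>p\<in>{(i,j). S$i$j = 0}. smooth_on U (F p)) \<and>
      qual_class S \<inter> U = {y\<in>U. \<forall>p\<in>{(i,j). S$i$j = 0}. F p y = 0} \<and>
      (\<forall>p\<in>{(i,j). S$i$j = 0}. \<forall>y\<in>qual_class S \<inter> U. (F p has_derivative F' p y) (at y)) \<and>
      (\<forall>y\<in>qual_class S \<inter> U. \<forall>w. \<exists>v. \<forall>p\<in>{(i,j). S$i$j = 0}. F' p y v = w p)"
    using U
    by (intro exI[of _ U] exI[of _ "\<lambda>(i,j) y. y$i$j"] exI[of _ "\<lambda>(i,j) y v. v$i$j"])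
      (auto intro!: smooth_on_real_polynomial_function split: prod.splits)
qed simp

text \<open>The equations for \<open>(i,j)\<close> and \<open>(j,i)\<close> coincide, so keeping
  both would prevent the derivative from being onto. The injection \<open>e\<close> orders the rows
  and selects one equation per unordered pair.\<close>

lemma smooth_submanifold_row_orthogonal: "smooth_submanifold (row_orthogonal :: (real^'n^'m) set)"
proof -
  obtain e :: "'m \<Rightarrow> nat" where e: "inj e"
    using finite_imp_inj_to_nat_seg[OF finite_class.finite_UNIV] by blast
  define P where "P = {(i,j). e i \<le> e j}"
  define F :: "'m \<times> 'm \<Rightarrow> real^'n^'m \<Rightarrow> real"
    where "F p y = y$fst p \<bullet> y$snd p - (if fst p = snd p then 1 else 0)" for p y
  define F' :: "'m \<times> 'm \<Rightarrow> real^'n^'m \<Rightarrow> real^'n^'m \<Rightarrow> real"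
    where "F' p y v = y$fst p \<bullet> v$snd p + v$fst p \<bullet> y$snd p" for p y v
  have "row_orthogonal = {y. \<forall>p\<in>P. F p y = 0}"
  proof -
    have "y \<in> row_orthogonal" if "\<forall>p\<in>P. F p y = 0" for y
    proof -
      have *: "y$i \<bullet> y$j = (if i = j then 1 else 0)" if "e i \<le> e j" for i j
        using that bspec[OF \<open>\<forall>p\<in>P. F p y = 0\<close>, of "(i,j)"] by (simp add: P_def F_def)
      have "y$i \<bullet> y$j = (if i = j then 1 else 0)" for i j
        using *[of i j] *[of j i] by (cases "e i \<le> e j") (auto simp: inner_commute)
      then show ?thesis
        by (simp add: row_orthogonal_iff)
    qed
    moreover have "F p y = 0" if "y \<in> row_orthogonal" for y p
      using that by (simp add: row_orthogonal_iff F_def)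
    ultimately show ?thesis
      by blast
  qed
  moreover have "smooth_on UNIV (F p)" for p
  proof -
    have "real_polynomial_function (\<lambda>y::real^'n^'m. \<Sum>k\<in>UNIV. y$fst p$k * y$snd p$k)"
      by (intro real_polynomial_function_sum real_polynomial_function.intros(4)
          real_polynomial_function.intros(1) finite_class.finite_UNIV bounded_linear_matrix_component)
    then have "real_polynomial_function (F p)"
      unfolding F_def[abs_def] by (intro real_polynomial_function_diff real_polynomial_function.intros(2))
        (simp add: inner_vec_def)
    then show ?thesis
      by (rule smooth_on_real_polynomial_function)
  qed
  moreover have "(F p has_derivative F' p y) (at y)" for p y
  proof -
    have "((\<lambda>y::real^'n^'m. y$i) has_derivative (\<lambda>y. y$i)) (at y)" for i
      by (intro bounded_linear_imp_has_derivative bounded_linear_vec_nth)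
    then show ?thesis
      unfolding F_def[abs_def] F'_def[abs_def] by (auto intro!: derivative_eq_intros)
  qed
  moreover have "\<exists>v. \<forall>p\<in>P. F' p y v = w p" if y: "y \<in> row_orthogonal" for y w
  proof -
    \<comment> \<open>The prescribed values are extended to a symmetric matrix \<open>W\<close>;
      then \<open>(1/2) *\<^sub>R (W ** y)\<close> is a preimage, because
      \<open>y ** transpose y\<close> is the identity.\<close>
    define W :: "real^'m^'m" where "W = (\<chi> i j. if e i \<le> e j then w (i,j) else w (j,i))"
    have W: "transpose W = W"
      using e by (auto simp: vec_eq_iff W_def transpose_def dest: injD le_antisym)
    have yy: "y ** transpose y = mat 1"
      using y by (simp add: row_orthogonal_def)
    define v where "v = (1/2) *\<^sub>R (W ** y)"
    have "v ** transpose y = (1/2) *\<^sub>R W" 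
      by (simp add: v_def matrix_mult_simps matrix_mul_assoc[symmetric] yy)
    then have vy: "v$i \<bullet> y$j = W$i$j / 2" for i j
      by (simp flip: matrix_mult_transpose_component)
    have "W$j$i = W$i$j" for i j
      using arg_cong[OF W, of "\<lambda>A. A$i$j"] by (simp add: transpose_def)
    then have "F' (i,j) y v = W$i$j" for i j
      using vy[of i j] vy[of j i] by (simp add: F'_def inner_commute[of "y$i"])
    then show ?thesis
      by (intro exI[of _ v]) (auto simp: P_def W_def)
  qed
  ultimately show ?thesis
    by (intro smooth_submanifoldI[of P] exI[of _ UNIV] exI[of _ F] exI[of _ F']) auto
qed

section \<open>The two tangent spaces\<close>

lemma sgn_add_dominated:
  fixes a b :: real
  assumes "\<bar>b\<bar> < \<bar>a\<bar>"
  shows "sgn (a + b) = sgn a"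
  using assms by (auto simp: sgn_real_def)

lemma abs_matrix_component_le_norm:
  fixes A :: "real^'n^'m"
  shows "\<bar>A$i$j\<bar> \<le> norm A"
  using Finite_Cartesian_Product.norm_nth_le[of A i] Finite_Cartesian_Product.norm_nth_le[of "A$i" j] by simp

lemma matrix_nonzero_components_bounded_below:
  fixes A :: "real^'n^'m"
  obtains c where "c > 0" "\<And>i j. A$i$j \<noteq> 0 \<Longrightarrow> c \<le> \<bar>A$i$j\<bar>"
proof
  \<comment> \<open>The inserted \<open>1\<close> keeps the set nonempty when \<open>A\<close> is
    zero.\<close>
  let ?c = "Min (insert 1 ((\<lambda>(i,j). \<bar>A$i$j\<bar>) ` {(i,j). A$i$j \<noteq> 0}))"
  show "?c > 0" "A$i$j \<noteq> 0 \<Longrightarrow> ?c \<le> \<bar>A$i$j\<bar>" for i j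
    by (auto intro!: Min_le)
qed

text \<open>Along a curve in the class the zero entries stay zero, hence so do their derivatives.
  Conversely, the line through \<open>Q\<close> in direction \<open>V\<close> stays in the class for
  a short time.\<close>

lemma tangent_space_qual_class:
  fixes Q :: "real^'n^'m"
  assumes Q: "Q \<in> qual_class S"
  shows "tangent_space (qual_class S) Q = {V. \<forall>i j. Q$i$j = 0 \<longrightarrow> V$i$j = 0}"
proof (intro equalityI subsetI CollectI allI impI)
  fix V i j
  assume "V \<in> tangent_space (qual_class S) Q" and "Q$i$j = 0"
  then obtain \<epsilon> \<gamma> where \<epsilon>: "\<epsilon> > 0" and \<gamma>: "\<gamma> ` {-\<epsilon><..<\<epsilon>} \<subseteq> qual_class S"
    and V: "(\<gamma> has_vector_derivative V) (at 0)"
    by (auto simp: tangent_space_def)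
  have "sgn_mat Q = S"
    using Q by (simp add: qual_class_def)
  with \<open>Q$i$j = 0\<close> have "S$i$j = 0"
    by (auto simp: sgn_mat_def)
  then have zero: "\<gamma> t$i$j = 0" if "t \<in> {-\<epsilon><..<\<epsilon>}" for t
    using \<gamma> that by (force simp: qual_class_def sgn_mat_def sgn_0_0)
  have "((\<lambda>t. \<gamma> t$i$j) has_vector_derivative V$i$j) (at 0)"
    using bounded_linear.has_vector_derivative[OF bounded_linear_matrix_component V] .
  then have "((\<lambda>t. 0) has_vector_derivative V$i$j) (at 0)"
    by (rule has_vector_derivative_transform_within_open[of _ _ _ "{-\<epsilon><..<\<epsilon>}"]) (use \<epsilon> zero in auto)
  then show "V$i$j = 0"
    using vector_derivative_unique_at has_vector_derivative_const by blast
next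
  fix V :: "real^'n^'m"
  assume "V \<in> {V. \<forall>i j. Q$i$j = 0 \<longrightarrow> V$i$j = 0}"
  then have V: "V$i$j = 0" if "Q$i$j = 0" for i j
    using that by blast
  obtain c where c: "c > 0" "\<And>i j. Q$i$j \<noteq> 0 \<Longrightarrow> c \<le> \<bar>Q$i$j\<bar>"
    using matrix_nonzero_components_bounded_below[of Q] by blast
  \<comment> \<open>Adding 1 keeps the denominator positive even for \<open>V = 0\<close>.\<close>
  define \<epsilon> where "\<epsilon> = c / (norm V + 1)"
  have \<epsilon>: "\<epsilon> > 0"
    using c by (simp add: \<epsilon>_def add_nonneg_pos)
  have "sgn (Q$i$j + t * V$i$j) = sgn (Q$i$j)" if "\<bar>t\<bar> < \<epsilon>" for t i j
  proof (cases "Q$i$j = 0")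
    case False
    have "\<bar>t * V$i$j\<bar> \<le> \<bar>t\<bar> * (norm V + 1)"
      using abs_matrix_component_le_norm[of V i j] by (simp add: abs_mult mult_left_mono)
    also have "\<dots> < c"
      using that by (simp add: \<epsilon>_def pos_less_divide_eq add_nonneg_pos)
    finally have "\<bar>t * V$i$j\<bar> < \<bar>Q$i$j\<bar>"
      using c(2)[OF False] by linarith
    then show ?thesis
      by (rule sgn_add_dominated)
  qed (simp add: V)
  then have "sgn_mat (Q + t *\<^sub>R V) = S" if "\<bar>t\<bar> < \<epsilon>" for t
    using Q that by (auto simp: qual_class_def sgn_mat_def)
  then have "(\<lambda>t. Q + t *\<^sub>R V) ` {-\<epsilon><..<\<epsilon>} \<subseteq> qual_class S"
    by (auto simp: qual_class_def)
  moreover have "((\<lambda>t. Q + t *\<^sub>R V) has_vector_derivative V) (at 0)"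
    by (auto intro!: derivative_eq_intros)
  ultimately show "V \<in> tangent_space (qual_class S) Q"
    unfolding tangent_space_def using \<epsilon> smooth_on_affine_curve
    by (intro CollectI exI[of _ \<epsilon>] conjI exI[of _ "\<lambda>t. Q + t *\<^sub>R V"]) simp_all
qed

lemma has_vector_derivative_matrix_mult_transpose:
  fixes \<gamma> :: "real \<Rightarrow> real^'n^'m"
  assumes "(\<gamma> has_vector_derivative V) (at t)"
  shows "((\<lambda>t. \<gamma> t ** transpose (\<gamma> t)) has_vector_derivative \<gamma> t ** transpose V + V ** transpose (\<gamma> t)) (at t)"
  using bounded_bilinear.has_vector_derivative[OF bounded_bilinear_matrix_mult assms
      bounded_linear.has_vector_derivative[OF bounded_linear_transpose assms]] .

text \<open>The derivative of \<open>\<gamma> t ** transpose (\<gamma> t)\<close> is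
  \<open>\<gamma> t ** (K + transpose K) ** transpose (\<gamma> t)\<close>, which vanishes, so this
  product keeps its initial value.\<close>

lemma linear_ode_skew_row_orthogonal:
  fixes \<gamma> :: "real \<Rightarrow> real^'n^'m" and K :: "real^'n^'n"
  assumes K: "transpose K = - K" and "\<gamma> 0 \<in> row_orthogonal"
    and ode: "\<And>t. (\<gamma> has_vector_derivative \<gamma> t ** K) (at t)"
  shows "\<gamma> t \<in> row_orthogonal"
proof -
  have "((\<lambda>t. \<gamma> t ** transpose (\<gamma> t)) has_vector_derivative 0) (at t)" for t
    using has_vector_derivative_matrix_mult_transpose[OF ode, of t]
    by (simp add: transpose_simps K matrix_mult_simps matrix_mul_assoc)
  then have "\<gamma> t ** transpose (\<gamma> t) = \<gamma> 0 ** transpose (\<gamma> 0)"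
    using has_derivative_zero_unique_connected[of UNIV "\<lambda>t. \<gamma> t ** transpose (\<gamma> t)" t 0]
    by (simp add: has_vector_derivative_def)
  with assms show ?thesis
    by (simp add: row_orthogonal_def)
qed

lemma tangent_space_row_orthogonal:
  fixes Q :: "real^'n^'m"
  assumes Q: "Q \<in> row_orthogonal"
  shows "tangent_space row_orthogonal Q = {V. V ** transpose Q + Q ** transpose V = 0}"
proof (intro equalityI subsetI CollectI)
  fix V :: "real^'n^'m"
  assume "V \<in> tangent_space row_orthogonal Q"
  then obtain \<epsilon> \<gamma> where \<epsilon>: "\<epsilon> > 0" and \<gamma>: "\<gamma> ` {-\<epsilon><..<\<epsilon>} \<subseteq> row_orthogonal"
    and V: "\<gamma> 0 = Q" "(\<gamma> has_vector_derivative V) (at 0)"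
    by (auto simp: tangent_space_def)
  have const: "\<gamma> t ** transpose (\<gamma> t) = mat 1" if "t \<in> {-\<epsilon><..<\<epsilon>}" for t
    using \<gamma> that unfolding row_orthogonal_def by blast
  have "((\<lambda>t. \<gamma> t ** transpose (\<gamma> t)) has_vector_derivative Q ** transpose V + V ** transpose Q) (at 0)"
    using has_vector_derivative_matrix_mult_transpose[OF V(2)] V(1) by simp
  then have "((\<lambda>t. mat 1) has_vector_derivative Q ** transpose V + V ** transpose Q) (at 0)"
    by (rule has_vector_derivative_transform_within_open[of _ _ _ "{-\<epsilon><..<\<epsilon>}"]) (use \<epsilon> const in auto)
  then show "V ** transpose Q + Q ** transpose V = 0"
    using vector_derivative_unique_at has_vector_derivative_const add.commute by metis
next
  fix V :: "real^'n^'m"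
  assume "V \<in> {V. V ** transpose Q + Q ** transpose V = 0}"
  then have V: "Q ** transpose V = - (V ** transpose Q)"
    by (simp add: eq_neg_iff_add_eq_0 add.commute)
  have QQ: "Q ** transpose Q = mat 1"
    using Q by (simp add: row_orthogonal_def)
  \<comment> \<open>The first two terms form a skew matrix that \<open>Q\<close> maps to
    \<open>V + V ** transpose Q ** Q\<close>. The third removes the excess and is itself skew
    because \<open>V ** transpose Q\<close> is.\<close>
  define K where "K = transpose Q ** V - transpose V ** Q - transpose Q ** (V ** transpose Q) ** Q"
  have K: "transpose K = - K"
  proof -
    have "transpose (transpose Q ** (V ** transpose Q) ** Q) = transpose Q ** (Q ** transpose V) ** Q"
      by (simp add: transpose_simps matrix_mul_assoc)
    also have "\<dots> = - (transpose Q ** (V ** transpose Q) ** Q)"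
      unfolding V by (simp add: matrix_mult_simps)
    finally show ?thesis
      by (simp add: K_def transpose_simps)
  qed
  have QK: "Q ** K = V"
  proof -
    have "Q ** K = (Q ** transpose Q) ** V - (Q ** transpose V) ** Q - (Q ** transpose Q) ** (V ** transpose Q) ** Q"
      by (simp add: K_def matrix_mult_simps matrix_mul_assoc)
    then show ?thesis
      unfolding V QQ by (simp add: matrix_mult_simps)
  qed
  have lin: "bounded_linear (\<lambda>X::real^'n^'m. X ** K)"
    using bounded_bilinear.bounded_linear_left[OF bounded_bilinear_matrix_mult] .
  obtain \<gamma> where \<gamma>: "\<gamma> 0 = Q" "\<And>t. (\<gamma> has_vector_derivative \<gamma> t ** K) (at t)"
    using linear_ode_solution_exists[OF lin] by blast
  have "\<gamma> t \<in> row_orthogonal" for t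
    using linear_ode_skew_row_orthogonal[OF K _ \<gamma>(2)] \<gamma>(1) Q by simp
  then show "V \<in> tangent_space row_orthogonal Q"
    unfolding tangent_space_def
    using \<gamma>(1) \<gamma>(2)[of 0] QK smooth_on_linear_ode_solution[OF lin \<gamma>(2)]
    by (intro CollectI exI[of _ 1] conjI exI[of _ \<gamma>]) auto
qed

section \<open>Transversality and the SIPP\<close>

text \<open>Since \<open>transpose Q\<close> is a right inverse, \<open>Q\<close> acts surjectively
  and so has full row rank.\<close>

lemma SIPP_row_orthogonal_iff:
  fixes Q :: "real^'n^'m"
  assumes "CARD('m) \<le> CARD('n)" "Q \<in> row_orthogonal"
  shows "SIPP Q \<longleftrightarrow> (\<forall>X. transpose X = X \<and> (X ** Q) \<circ>\<^sub>H Q = 0 \<longrightarrow> X = 0)"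
proof -
  have QQ: "Q ** transpose Q = mat 1"
    using assms by (simp add: row_orthogonal_def)
  have "surj ((*v) Q)"
    using QQ matrix_right_invertible_surjective by blast
  then have "rank Q = CARD('m)"
    by (simp add: full_rank_surjective)
  with assms show ?thesis
    by (simp add: SIPP_def)
qed

text \<open>For symmetric \<open>X\<close> with \<open>(X ** Q) \<circ>\<^sub>H Q = 0\<close>, the
  matrix \<open>X ** Q\<close> is orthogonal to both tangent spaces, and every matrix orthogonal to
  both has this form. Right multiplication by \<open>transpose Q\<close> recovers \<open>X\<close>
  from \<open>X ** Q\<close>.\<close>

lemma intersect_transversally_iff_SIPP:
  fixes Q :: "real^'n^'m"
  assumes "CARD('m) \<le> CARD('n)" and Q: "Q \<in> row_orthogonal"
  shows "intersect_transversally (qual_class (sgn_mat Q)) row_orthogonal Q \<longleftrightarrow> SIPP Q"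
proof -
  define T\<^sub>1 :: "(real^'n^'m) set" where "T\<^sub>1 = {V. \<forall>i j. Q$i$j = 0 \<longrightarrow> V$i$j = 0}"
  define T\<^sub>2 :: "(real^'n^'m) set" where "T\<^sub>2 = {V. V ** transpose Q + Q ** transpose V = 0}"
  define T where "T = {u + v | u v. u \<in> T\<^sub>1 \<and> v \<in> T\<^sub>2}"
  have QQ: "Q ** transpose Q = mat 1"
    using Q by (simp add: row_orthogonal_def)
  have "Q \<in> qual_class (sgn_mat Q)"
    by (simp add: qual_class_def)
  then have trans_iff: "intersect_transversally (qual_class (sgn_mat Q)) row_orthogonal Q \<longleftrightarrow> T = UNIV"
    using Q unfolding intersect_transversally_def T_def T\<^sub>1_def T\<^sub>2_def
    by (simp add: tangent_space_qual_class tangent_space_row_orthogonal)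
  have "subspace T\<^sub>1"
    by (auto simp: subspace_def T\<^sub>1_def)
  moreover have "subspace T\<^sub>2"
  proof -
    have "linear (\<lambda>V. V ** transpose Q + Q ** transpose V)"
      by (intro linearI) (simp_all add: matrix_mult_simps transpose_simps scaleR_add_right)
    then show ?thesis
      unfolding T\<^sub>2_def by (rule linear_subspace_kernel)
  qed
  ultimately have "subspace T"
    unfolding T_def by (rule subspace_sums)
  have T\<^sub>1: "u \<in> T" if "u \<in> T\<^sub>1" for u
    using that subspace_0[OF \<open>subspace T\<^sub>2\<close>] unfolding T_def by force
  have T\<^sub>2: "v \<in> T" if "v \<in> T\<^sub>2" for v
    using that subspace_0[OF \<open>subspace T\<^sub>1\<close>] unfolding T_def by force
  have orth\<^sub>1: "N \<bullet> u = 0" if "N \<circ>\<^sub>H Q = 0" "u \<in> T\<^sub>1" for N u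
  proof -
    have "N$i$j * Q$i$j = 0" for i j
      using that(1) by (simp add: hadamard_def vec_eq_iff)
    then have "N$i$j * u$i$j = 0" for i j
      using that(2) by (auto simp: T\<^sub>1_def)
    then show ?thesis
      unfolding inner_vec_def inner_real_def by (intro sum.neutral ballI)
  qed
  have orth\<^sub>2: "(X ** Q) \<bullet> v = 0" if "transpose X = X" "v \<in> T\<^sub>2" for X v
  proof -
    have "transpose (v ** transpose Q) = - (v ** transpose Q)"
      using that(2) by (simp add: T\<^sub>2_def transpose_simps eq_neg_iff_add_eq_0 add.commute)
    then show ?thesis
      using that(1) by (simp add: matrix_mult_inner_adjoint symmetric_inner_skew)
  qed
  have "X = 0" if "T = UNIV" "transpose X = X" "(X ** Q) \<circ>\<^sub>H Q = 0" for X
  proof -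
    obtain u v where uv: "X ** Q = u + v" "u \<in> T\<^sub>1" "v \<in> T\<^sub>2"
      using \<open>T = UNIV\<close> unfolding T_def by blast
    have "(X ** Q) \<bullet> (u + v) = 0"
      using orth\<^sub>1 orth\<^sub>2 uv(2,3) that by (simp add: inner_add_right)
    then have "X ** Q = 0"
      using uv(1) by simp
    then have "X ** (Q ** transpose Q) = 0"
      by (simp add: matrix_mul_assoc)
    then show "X = 0"
      using QQ by simp
  qed
  moreover have "T = UNIV" if SIPP: "\<forall>X. transpose X = X \<and> (X ** Q) \<circ>\<^sub>H Q = 0 \<longrightarrow> X = 0"
  proof (rule ccontr)
    assume "T \<noteq> UNIV"
    have "span T = T"
      using \<open>subspace T\<close> by (simp only: span_eq_iff)
    then have "span T \<subset> span UNIV"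
      using \<open>T \<noteq> UNIV\<close> unfolding span_UNIV psubset_eq by (metis subset_UNIV)
    then obtain N where N: "N \<noteq> 0" "\<And>y. y \<in> T \<Longrightarrow> N \<bullet> y = 0"
      using orthogonal_to_subspace_exists_gen[of T UNIV] \<open>span T = T\<close> unfolding orthogonal_def by metis
    \<comment> \<open>\<open>u\<close> is the orthogonal projection of \<open>N\<close> onto
      \<open>T\<^sub>1\<close>. As \<open>N\<close> is normal to \<open>T\<^sub>1\<close>, it is
      zero, so \<open>N\<close> vanishes wherever \<open>Q\<close> does not.\<close>
    define u where "u = (\<chi> i j. if Q$i$j = 0 then 0 else N$i$j)"
    have "u \<in> T\<^sub>1"
      by (simp add: u_def T\<^sub>1_def)
    moreover have "N \<bullet> u = u \<bullet> u"
      unfolding u_def inner_vec_def by (intro sum.cong refl) simp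
    ultimately have "u = 0"
      using N(2) T\<^sub>1 by (metis inner_eq_zero_iff)
    then have "(if Q$i$j = 0 then 0 else N$i$j) = 0" for i j
      by (simp add: u_def vec_eq_iff)
    then have NQ: "N \<circ>\<^sub>H Q = 0"
      by (simp add: hadamard_def vec_eq_iff) metis
    \<comment> \<open>The normal space of \<open>row_orthogonal\<close> at \<open>Q\<close> is \<open>{X ** Q | X symmetric}\<close>: with \<open>X\<close> the symmetric
      part of \<open>N ** transpose Q\<close>, the matrix \<open>N - X ** Q\<close> is both tangent and normal.\<close>
    define X where "X = (1/2) *\<^sub>R (N ** transpose Q + Q ** transpose N)"
    have X: "transpose X = X"
      by (simp add: X_def transpose_simps add.commute)
    define W where "W = N - X ** Q"
    have "W ** transpose Q = N ** transpose Q - X"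
      by (simp add: W_def matrix_mult_simps matrix_mul_assoc[symmetric] QQ)
    moreover have "Q ** transpose W = Q ** transpose N - X"
      by (simp add: W_def transpose_simps matrix_mult_simps matrix_mul_assoc QQ X)
    moreover have "X + X = N ** transpose Q + Q ** transpose N"
      unfolding X_def scaleR_add_left[symmetric] by simp
    ultimately have "W ** transpose Q + Q ** transpose W = (X + X) - (X + X)"
      by (metis add_diff_add)
    then have "W \<in> T\<^sub>2"
      by (simp add: T\<^sub>2_def)
    then have "W \<bullet> W = 0"
      using N(2)[OF T\<^sub>2] orth\<^sub>2[OF X] by (simp add: W_def inner_diff_left)
    then have "N = X ** Q"
      by (simp add: W_def)
    with NQ X SIPP N(1) show False
      by fastforce
  qed
  ultimately show ?thesis
    using trans_iff SIPP_row_orthogonal_iff[OF assms] by blast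
qed

section \<open>Orthogonality of super patterns\<close>

text \<open>Instead of an implicit function, an open mapping theorem is used: \<open>\<Phi>\<close>
  is continuous and its derivative at 0 has a right inverse, so the image of a small ball around 0
  contains a neighbourhood of \<open>\<Phi> 0 = (mat 1, 0)\<close>.\<close>

lemma super_pattern_allows_orthogonality:
  fixes Q T :: "real^'n^'m"
  assumes trans: "intersect_transversally (qual_class (sgn_mat Q)) row_orthogonal Q"
    and T: "super_pattern (sgn_mat Q) T"
  shows "allows_orthogonality T"
proof -
  obtain R where R: "sign_pattern R" "T = pattern_fill (sgn_mat Q) R"
    using T by (auto simp: super_pattern_def)
  have Q: "Q \<in> row_orthogonal" "Q \<in> qual_class (sgn_mat Q)"
    using trans by (auto simp: intersect_transversally_def)
  then have QQ: "Q ** transpose Q = mat 1"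
    by (simp add: row_orthogonal_def)
  \<comment> \<open>A parameter \<open>(V, Y, s)\<close> yields the matrix
    \<open>Q + P V + s *\<^sub>R Z\<close>: \<open>P V\<close> changes only nonzero entries of
    \<open>Q\<close>, while \<open>s *\<^sub>R Z\<close> fills the zero entries according to
    \<open>R\<close>.\<close>
  define P where "P V = (\<chi> i j. if Q$i$j = 0 then 0 else V$i$j)" for V :: "real^'n^'m"
  define Z where "Z = (\<chi> i j. if Q$i$j = 0 then R$i$j else 0)"
  define L :: "(real^'n^'m) \<times> (real^'m^'m) \<times> real \<Rightarrow> real^'n^'m"
    where "L p = P (fst p) + snd (snd p) *\<^sub>R Z" for p
  have L: "bounded_linear L"
    unfolding linear_conv_bounded_linear[symmetric] L_def P_def
    by (intro linearI) (auto simp: vec_eq_iff algebra_simps)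
  \<comment> \<open>The term \<open>Y - transpose Y\<close> makes the derivative of \<open>\<Phi>\<close> onto, although \<open>A ** transpose A\<close> is always
    symmetric; it vanishes as soon as the value of \<open>\<Phi>\<close> is symmetric.\<close>
  define \<Phi> where "\<Phi> p = ((Q + L p) ** transpose (Q + L p) + (fst (snd p) - transpose (fst (snd p))), snd (snd p))" for p
  define \<Phi>' where "\<Phi>' p q = ((Q + L p) ** transpose (L q) + L q ** transpose (Q + L p)
    + (fst (snd q) - transpose (fst (snd q))), snd (snd q))" for p q
  have \<Phi>': "(\<Phi> has_derivative \<Phi>' p) (at p)" for p
  proof -
    have dL: "((\<lambda>p. Q + L p) has_derivative L) (at p)"
      using has_derivative_add[OF has_derivative_const bounded_linear_imp_has_derivative[OF L]] by simp
    have dS: "((\<lambda>p::(real^'n^'m) \<times> (real^'m^'m) \<times> real. fst (snd p) - transpose (fst (snd p)))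
      has_derivative (\<lambda>p. fst (snd p) - transpose (fst (snd p)))) (at p)"
      by (intro bounded_linear_imp_has_derivative bounded_linear_sub
          bounded_linear_compose[OF bounded_linear_transpose] bounded_linear_compose[OF bounded_linear_fst]
          bounded_linear_snd)
    have dE: "((\<lambda>p::(real^'n^'m) \<times> (real^'m^'m) \<times> real. snd (snd p)) has_derivative (\<lambda>p. snd (snd p))) (at p)"
      by (intro bounded_linear_imp_has_derivative bounded_linear_compose[OF bounded_linear_snd] bounded_linear_snd)
    show ?thesis
      unfolding \<Phi>_def[abs_def] \<Phi>'_def[abs_def]
      by (intro has_derivative_Pair has_derivative_add dS dE bounded_linear.has_derivative[OF bounded_linear_transpose]
          bounded_bilinear.FDERIV[OF bounded_bilinear_matrix_mult] dL)
  qed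
  have L0: "L 0 = 0"
    using linear_0[OF bounded_linear.linear[OF L]] .
  have "surj (\<Phi>' 0)"
    unfolding surj_def
  proof (intro allI)
    fix w :: "(real^'m^'m) \<times> real"
    \<comment> \<open>\<open>W\<close> is the symmetric part of the target, less the contribution of
      moving along \<open>Z\<close> by \<open>snd w\<close>; the nonzero entries must account for
      it.\<close>
    define W where "W = (1/2) *\<^sub>R (fst w + transpose (fst w)) - snd w *\<^sub>R (Z ** transpose Q + Q ** transpose Z)"
    have W: "transpose W = W"
      by (simp add: W_def transpose_simps add.commute)
    \<comment> \<open>\<open>Y\<close> is already skew, so \<open>Y - transpose Y\<close> doubles
      it; the factor 1/4 thus gives exactly the skew part of \<open>fst w\<close>.\<close>
    define Y where "Y = (1/4) *\<^sub>R (fst w - transpose (fst w))"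
    \<comment> \<open>The derivative of \<open>A ** transpose A\<close> at \<open>Q\<close> sends
      \<open>(1/2) *\<^sub>R (W ** Q)\<close> to \<open>W\<close> and annihilates the tangent vector
      \<open>v\<close>, so \<open>u\<close> alone produces \<open>W\<close>.\<close>
    obtain u v where uv: "(1/2) *\<^sub>R (W ** Q) = u + v"
      and "u \<in> tangent_space (qual_class (sgn_mat Q)) Q" "v \<in> tangent_space row_orthogonal Q"
      using trans unfolding intersect_transversally_def by blast
    then have u: "P u = u" and v: "v ** transpose Q + Q ** transpose v = 0"
      by (auto simp: tangent_space_qual_class[OF Q(2)] tangent_space_row_orthogonal[OF Q(1)] P_def vec_eq_iff)
    have "(u + v) ** transpose Q + Q ** transpose (u + v) = W"
      unfolding uv[symmetric]
      by (simp add: matrix_mult_simps transpose_simps matrix_mul_assoc[symmetric] QQ W)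
        (simp add: matrix_mul_assoc QQ flip: scaleR_add_left)
    then have "(u ** transpose Q + Q ** transpose u) + (v ** transpose Q + Q ** transpose v) = W"
      by (simp add: matrix_mult_simps transpose_simps ac_simps)
    then have "u ** transpose Q + Q ** transpose u = W"
      using v by simp
    then have "Q ** transpose (u + snd w *\<^sub>R Z) + (u + snd w *\<^sub>R Z) ** transpose Q
      = (1/2) *\<^sub>R (fst w + transpose (fst w))"
      by (simp add: W_def matrix_mult_simps transpose_simps algebra_simps)
    moreover have "Y - transpose Y = (1/2) *\<^sub>R (fst w - transpose (fst w))"
      by (simp add: Y_def transpose_simps vec_eq_iff algebra_simps)
    moreover have "\<Phi>' 0 (u, Y, snd w) = (Q ** transpose (u + snd w *\<^sub>R Z)
      + (u + snd w *\<^sub>R Z) ** transpose Q + (Y - transpose Y), snd w)"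
      unfolding \<Phi>'_def L0 by (simp add: L_def u)
    moreover have "(1/2) *\<^sub>R (B + C) + (1/2) *\<^sub>R (B - C) = B" for B C :: "real^'m^'m"
      by (simp add: vec_eq_iff algebra_simps)
    ultimately have "\<Phi>' 0 (u, Y, snd w) = w"
      by (simp add: prod_eq_iff)
    then show "\<exists>x. w = \<Phi>' 0 x"
      by metis
  qed
  then obtain g where g: "linear g" "\<Phi>' 0 \<circ> g = id"
    using linear_surjective_right_inverse[OF has_derivative_linear[OF \<Phi>']] by blast
  obtain c where c: "c > 0" "\<And>i j. Q$i$j \<noteq> 0 \<Longrightarrow> c \<le> \<bar>Q$i$j\<bar>"
    using matrix_nonzero_components_bounded_below[of Q] by blast
  \<comment> \<open>The radius \<open>c\<close> ensures that parameters in the ball cannot change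
    the sign of a nonzero entry.\<close>
  have "\<Phi> 0 \<in> interior (\<Phi> ` ball 0 c)"
  proof (rule sussmann_open_mapping[of UNIV])
    show "continuous_on UNIV \<Phi>"
      using \<Phi>' has_derivative_continuous continuous_at_imp_continuous_on by blast
    show "bounded_linear g"
      using g(1) linear_conv_bounded_linear by blast
  qed (use \<Phi>' g(2) c(1) in auto)
  moreover have "\<Phi> 0 = (mat 1, 0)"
    by (simp add: \<Phi>_def L0 QQ transpose_simps)
  ultimately obtain r where r: "r > 0" "ball (mat 1, 0) r \<subseteq> \<Phi> ` ball 0 c"
    unfolding mem_interior by auto
  \<comment> \<open>A strictly positive second component makes the former zero entries a positive
    multiple of those of \<open>R\<close>.\<close>
  have "(mat 1, r/2) \<in> ball (mat 1 :: real^'m^'m, 0::real) r"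
    using r(1) by (simp add: dist_Pair_Pair dist_real_def)
  then have "(mat 1, r/2) \<in> \<Phi> ` ball 0 c"
    using r(2) by blast
  then obtain p where "p \<in> ball 0 c" and \<Phi>p: "(mat 1, r/2) = \<Phi> p"
    by (rule imageE)
  then have p: "norm p < c"
    by simp
  define A where "A = Q + L p"
  define Y where "Y = fst (snd p)"
  have e: "snd (snd p) = r/2" and AY: "A ** transpose A + (Y - transpose Y) = mat 1"
    using \<Phi>p by (auto simp: \<Phi>_def A_def Y_def)
  \<comment> \<open>Transposing reverses the sign of the skew term only; adding the two equations
    eliminates it.\<close>
  have "transpose (A ** transpose A + (Y - transpose Y)) = mat 1"
    unfolding AY by simp
  then have "A ** transpose A + (transpose Y - Y) = mat 1"
    by (simp add: transpose_simps)
  moreover have "2 *\<^sub>R (A ** transpose A)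
    = (A ** transpose A + (Y - transpose Y)) + (A ** transpose A + (transpose Y - Y))"
    by (simp add: scaleR_2)
  ultimately have "2 *\<^sub>R (A ** transpose A) = 2 *\<^sub>R mat 1"
    unfolding AY by (simp only: scaleR_2)
  then have "A \<in> row_orthogonal"
    by (simp add: row_orthogonal_def)
  moreover have "sgn (A$i$j) = T$i$j" for i j
  proof (cases "Q$i$j = 0")
    case True
    then have "A$i$j = r/2 * R$i$j"
      by (simp add: A_def L_def P_def Z_def e)
    moreover have "R$i$j \<in> {0, 1, -1}"
      using R(1) by (simp add: sign_pattern_def)
    ultimately show ?thesis
      using True r(1) R(2) by (auto simp: pattern_fill_def sgn_mat_def sgn_mult)
  next
    case False
    then have "A$i$j = Q$i$j + fst p$i$j"
      by (simp add: A_def L_def P_def Z_def)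
    moreover have "\<bar>fst p$i$j\<bar> < \<bar>Q$i$j\<bar>"
      using abs_matrix_component_le_norm[of "fst p" i j] norm_fst_le[of "fst p" "snd p"] p c(2)[OF False]
      by simp
    ultimately show ?thesis
      using False R(2) by (simp add: sgn_add_dominated pattern_fill_def sgn_mat_def sgn_0_0)
  qed
  then have "A \<in> qual_class T"
    by (simp add: qual_class_def sgn_mat_def vec_eq_iff)
  ultimately show ?thesis
    by (auto simp: allows_orthogonality_def)
qed

theorem theorem4p5:
  fixes Q S :: "real^'n^'m"
  assumes "CARD('m) \<le> CARD('n)"
    and "Q \<in> row_orthogonal"
    and "S = sgn_mat Q"
  shows "smooth_submanifold (qual_class S) \<and>
    smooth_submanifold (row_orthogonal :: (real^'n^'m) set) \<and>
    (intersect_transversally (qual_class S) row_orthogonal Q \<longleftrightarrow> SIPP Q) \<and>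
    (SIPP Q \<longrightarrow> (\<forall>T. super_pattern S T \<longrightarrow> allows_orthogonality T))"
  using smooth_submanifold_qual_class smooth_submanifold_row_orthogonal
    intersect_transversally_iff_SIPP[OF assms(1,2)] super_pattern_allows_orthogonality assms(3)
  by blast

end
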